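(* For every integer $n\ge 1$, the Stirling coefficient $\gamma_n$ is given by $$\gamma_n=(-2)^n\sum_{(m_1,\ldots,m_{2n})\in P_{2n}} \frac{(-2)^m\,\left(\tfrac12\right)_{m+n}}{\prod_{k=1}^{2n} m_k!\,\big((k+2)!\big)^{m_k}},$$ where $m=m_1+m_2+\cdots+m_{2n}$ and the sum runs over the set $$P_{2n}=\Big\{(m_1,m_2,\ldots,m_{2n}):\ m_k\in\mathbb{Z}_{\ge 0},\ \sum_{k=1}^{2n}k\,m_k=2n\Big\}.$$
   Context: The Stirling coefficients $\gamma_n$ ($n=0,1,2,\ldots$) are the real numbers defined by the Poincaré asymptotic expansion of the gamma function $$\Gamma(x)\sim\sqrt{2\pi}\,x^{x-\frac12}e^{-x}\sum_{n=0}^\infty\frac{(-1)^n\gamma_n}{x^n}\qquad (x\to+\infty),$$ so that $\gamma_0=1$, $\gamma_1=-\tfrac1{12}$, $\gamma_2=\tfrac1{288}$, $\gamma_3=\tfrac{139}{51840}$, $\gamma_4=-\tfrac{571}{2488320}$. Pochhammer's symbol is $(a)_n=\Gamma(a+n)/\Gamma(a)$. *)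

theory Defs
  imports "HOL-Analysis.Analysis" "HOL-Library.Landau_Symbols"
begin

definition poincare_expansion :: "(real \<Rightarrow> real) \<Rightarrow> (nat \<Rightarrow> real) \<Rightarrow> bool" where
  "poincare_expansion f a \<longleftrightarrow>
     (\<forall>N. (\<lambda>x. f x - (\<Sum>n\<le>N. a n / x ^ n)) \<in> o[at_top](\<lambda>x. 1 / x ^ N))"

lemma poincare_expansion_unique:
  assumes "poincare_expansion f a" "poincare_expansion f b"
  shows "a = b"
proof
  fix n show "a n = b n"
  proof (induction n rule: less_induct)
    case (less n)
    have "(\<lambda>x. (f x - (\<Sum>k\<le>n. a k / x ^ k)) - (f x - (\<Sum>k\<le>n. b k / x ^ k)))
            \<in> o[at_top](\<lambda>x::real. 1 / x ^ n)"
      using assms unfolding poincare_expansion_def by (intro sum_in_smallo(2)[of "\<lambda>x. f x - (\<Sum>k\<le>n. a k / x ^ k)" _ _ "\<lambda>x. f x - (\<Sum>k\<le>n. b k / x ^ k)"]) auto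
    moreover have "(f x - (\<Sum>k\<le>n. a k / x ^ k)) - (f x - (\<Sum>k\<le>n. b k / x ^ k))
                     = (b n - a n) * (1 / x ^ n)" for x
    proof -
      have "(\<Sum>k<n. a k / x ^ k) = (\<Sum>k<n. b k / x ^ k)"
        using less by simp
      then show ?thesis
        by (simp add: lessThan_Suc_atMost [symmetric] algebra_simps diff_divide_distrib)
    qed
    ultimately have *: "(\<lambda>x. (b n - a n) * (1 / x ^ n)) \<in> o[at_top](\<lambda>x::real. 1 / x ^ n)"
      by simp
    show ?case
    proof (rule ccontr)
      assume "a n \<noteq> b n"
      with * have "(\<lambda>x. 1 / x ^ n) \<in> o[at_top](\<lambda>x::real. 1 / x ^ n)"
        by (subst (asm) landau_o.small.cmult_in_iff) auto
      then have "eventually (\<lambda>x::real. 1 / x ^ n = 0) at_top"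
        by (simp add: landau_o.small_refl_iff)
      moreover have "eventually (\<lambda>x::real. 1 / x ^ n \<noteq> 0) at_top"
        using eventually_gt_at_top[of 0] by eventually_elim auto
      ultimately have "eventually (\<lambda>x::real. False) at_top"
        by eventually_elim simp
      then show False by simp
    qed
  qed
qed

definition stirling_coeff :: "nat \<Rightarrow> real" where
  "stirling_coeff = (THE g. poincare_expansion
     (\<lambda>x. Gamma x / (sqrt (2 * pi) * x powr (x - 1/2) * exp (- x)))
     (\<lambda>n. (- 1) ^ n * g n))"

text \<open>The definite description is legitimate because at most one sequence qualifies:\<close>

lemma stirling_coeff_eqI:
  assumes "poincare_expansion
     (\<lambda>x. Gamma x / (sqrt (2 * pi) * x powr (x - 1/2) * exp (- x)))
     (\<lambda>n. (- 1) ^ n * g n)"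
  shows "stirling_coeff = g"
  unfolding stirling_coeff_def
proof (rule the_equality)
  fix h assume "poincare_expansion
     (\<lambda>x. Gamma x / (sqrt (2 * pi) * x powr (x - 1/2) * exp (- x)))
     (\<lambda>n. (- 1) ^ n * h n)"
  from poincare_expansion_unique[OF this assms]
  have "(- 1) ^ n * h n = (- 1) ^ n * g n" for n by (rule fun_cong)
  then show "h = g" by (intro ext) simp
qed (fact assms)

text \<open>A tuple \<open>(m\<^sub>1, \<dots>, m\<^sub>N)\<close> is a function on \<open>{1..N}\<close>, made canonical by extensionality so
  that each tuple is represented, and hence summed over, exactly once.\<close>

definition weighted_tuples :: "nat \<Rightarrow> (nat \<Rightarrow> nat) set" where
  "weighted_tuples N = {m \<in> {1..N} \<rightarrow>\<^sub>E UNIV. (\<Sum>k=1..N. k * m k) = N}"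

lemma finite_weighted_tuples: "finite (weighted_tuples N)"
proof (rule finite_subset)
  show "weighted_tuples N \<subseteq> {1..N} \<rightarrow>\<^sub>E {..N}"
  proof
    fix m assume m: "m \<in> weighted_tuples N"
    have "m k \<le> N" if k: "k \<in> {1..N}" for k
    proof -
      have "m k \<le> k * m k" using k by simp
      also have "\<dots> \<le> (\<Sum>k=1..N. k * m k)"
        by (rule member_le_sum[OF k]) auto
      also have "\<dots> = N" using m by (simp add: weighted_tuples_def)
      finally show ?thesis .
    qed
    with m show "m \<in> {1..N} \<rightarrow>\<^sub>E {..N}"
      by (auto simp: weighted_tuples_def PiE_iff)
  qed
qed (intro finite_PiE; simp)

end

theory Submission
  imports Defs "HOL-Probability.Distributions" "HOL-Probability.Sinc_Integral"
begin

text \<open>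
  The proof is Laplace's method with an explicit remainder. Substituting \<open>t = x exp (u / sqrt x)\<close> in
  Euler's integral turns \<open>Gamma x / (x powr (x - 1/2) * exp (- x))\<close> into the integral over \<open>u\<close> of
  \<open>exp (- x (exp z - 1 - z))\<close> with \<open>z = u / sqrt x\<close>. Splitting off the Gaussian \<open>exp (- u\<^sup>2/2)\<close>
  leaves the exponential of a power series in \<open>z\<close> with coefficients \<open>- u\<^sup>2 / (k+2)!\<close>, \<open>k \<ge> 1\<close>. The
  Taylor coefficients of such an exponential are the sums over weighted tuples: both sequences
  satisfy the recursion coming from \<open>E' = A' E\<close> for \<open>E = exp A\<close>. Truncating at order \<open>2n\<close> in \<open>z\<close> costs
  \<open>O(x powr (- n - 1/2))\<close>, uniformly against an integrable function of \<open>u\<close>. Odd orders integrate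
  to zero by parity, and the even Gaussian moments \<open>2\<^sup>k (1/2)\<^sub>k\<close> give the Pochhammer symbols.
\<close>

section \<open>Exponentials of power series: coefficients as sums over weighted tuples\<close>

text \<open>The coefficient of \<open>z ^ N\<close> in the exponential of the series with
  coefficients \<open>a k\<close>, \<open>k \<ge> 1\<close>; equivalently the complete Bell
  polynomial at the arguments \<open>fact k * a k\<close>, divided by \<open>fact N\<close>.\<close>

definition exp_coeff :: "(nat \<Rightarrow> real) \<Rightarrow> nat \<Rightarrow> real" where
  "exp_coeff a N = (\<Sum>m\<in>weighted_tuples N. \<Prod>k=1..N. a k ^ m k / fact (m k))"

text \<open>Zero-padding all tuples to one length \<open>L\<close> makes it possible to compare tuples of different weights.\<close>

definition padded_tuples :: "nat \<Rightarrow> nat \<Rightarrow> (nat \<Rightarrow> nat) set" where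
  "padded_tuples L N = {m. (\<forall>k. k \<notin> {1..L} \<longrightarrow> m k = 0) \<and> (\<Sum>k=1..L. k * m k) = N}"

lemma le_weighted_sum:
  fixes m :: "nat \<Rightarrow> nat"
  assumes "(\<Sum>k=1..L. k * m k) = N" "k \<in> {1..L}"
  shows "k * m k \<le> N" "m k \<le> N"
proof -
  show "k * m k \<le> N"
    unfolding assms(1)[symmetric] by (rule member_le_sum[OF assms(2)]) auto
  moreover have "m k \<le> k * m k" using assms(2) by simp
  ultimately show "m k \<le> N" by linarith
qed

text \<open>In a tuple of weight \<open>N\<close> every entry at an index above \<open>N\<close>
  vanishes, so restriction to \<open>{1..N}\<close> and extension by zero are mutually
  inverse.\<close>

lemma exp_coeff_padded:
  assumes "N \<le> L"
  shows "exp_coeff a N = (\<Sum>m\<in>padded_tuples L N. \<Prod>k=1..L. a k ^ m k / fact (m k))"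
  unfolding exp_coeff_def
proof (rule sum.reindex_bij_witness
    [of _ "\<lambda>m. restrict m {1..N}" "\<lambda>m k. if k \<in> {1..N} then m k else 0"])
  have split: "{1..L} = {1..N} \<union> {N<..L}" using assms by auto
  have sum_pad: "(\<Sum>k=1..L. k * (if k \<in> {1..N} then m k else 0)) = (\<Sum>k=1..N. k * m k)"
    for m :: "nat \<Rightarrow> nat"
    unfolding split by (subst sum.union_disjoint) auto
  show "restrict (\<lambda>k. if k \<in> {1..N} then m k else 0) {1..N} = m" if "m \<in> weighted_tuples N" for m
    using that by (auto simp: weighted_tuples_def PiE_def extensional_def restrict_def)
  show "(\<lambda>k. if k \<in> {1..N} then m k else 0) \<in> padded_tuples L N" if "m \<in> weighted_tuples N" for m
    using that sum_pad[of m] assms by (auto simp: weighted_tuples_def padded_tuples_def)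
  show "(\<Prod>k=1..L. a k ^ (if k \<in> {1..N} then m k else 0) / fact (if k \<in> {1..N} then m k else 0))
      = (\<Prod>k=1..N. a k ^ m k / fact (m k))" if "m \<in> weighted_tuples N" for m
    unfolding split by (subst prod.union_disjoint) auto
  fix m assume m: "m \<in> padded_tuples L N"
  have zero: "m k = 0" if "k \<notin> {1..N}" for k
  proof (cases "k \<in> {1..L}")
    case True
    then have "k * m k \<le> N" using m le_weighted_sum[of m L N k] by (auto simp: padded_tuples_def)
    with that True show ?thesis by (cases "m k") auto
  next
    case False
    with m show ?thesis by (auto simp: padded_tuples_def)
  qed
  show eq: "(\<lambda>k. if k \<in> {1..N} then restrict m {1..N} k else 0) = m"
    using zero by (auto simp: fun_eq_iff)
  have "(\<Sum>k=1..N. k * m k) = (\<Sum>k=1..N. k * restrict m {1..N} k)" by (intro sum.cong) auto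
  also have "\<dots> = (\<Sum>k=1..L. k * m k)" unfolding sum_pad[symmetric] eq[THEN fun_cong] ..
  also have "\<dots> = N" using m by (simp add: padded_tuples_def)
  finally have "(\<Sum>k=1..N. k * m k) = N" .
  then show "restrict m {1..N} \<in> weighted_tuples N"
    by (auto simp: weighted_tuples_def)
qed

lemma finite_padded_tuples: "finite (padded_tuples L N)"
proof -
  have "padded_tuples L N \<subseteq> {m. \<forall>k. (k \<in> {1..L} \<longrightarrow> m k \<in> {..N}) \<and> (k \<notin> {1..L} \<longrightarrow> m k = 0)}"
    unfolding padded_tuples_def atMost_iff using le_weighted_sum(2) by blast
  then show ?thesis
    by (rule finite_subset) (rule finite_set_of_finite_funs, auto)
qed

text \<open>Since \<open>m k / fact (m k)\<close> equals \<open>1 / fact (m k - 1)\<close> for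
  positive \<open>m k\<close>, lowering entry \<open>k\<close> by one splits off a factor
  \<open>a k\<close>. This is a bijection from the tuples with \<open>m k > 0\<close> onto those of
  weight \<open>N - k\<close>; tuples with \<open>m k = 0\<close> contribute nothing.\<close>

lemma padded_tuples_decrement:
  assumes k: "k \<in> {1..L}" "k \<le> N"
  shows "(\<Sum>m\<in>padded_tuples L N. real (m k) * (\<Prod>i=1..L. a i ^ m i / fact (m i)))
    = a k * (\<Sum>m\<in>padded_tuples L (N - k). \<Prod>i=1..L. a i ^ m i / fact (m i))"
proof -
  let ?w = "\<lambda>m. \<Prod>i=1..L. a i ^ m i / fact (m i)"
  have decomp: "(\<Sum>i=1..L. i * m i) = k * m k + (\<Sum>i\<in>{1..L}-{k}. i * m i)" for m :: "nat \<Rightarrow> nat"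
    using k by (subst sum.remove[of _ k]) auto
  have decomp': "?w m = a k ^ m k / fact (m k) * (\<Prod>i\<in>{1..L}-{k}. a i ^ m i / fact (m i))" for m
    using k by (subst prod.remove[of _ k]) auto
  have "(\<Sum>m\<in>padded_tuples L N. real (m k) * ?w m)
      = (\<Sum>m\<in>{m\<in>padded_tuples L N. m k > 0}. real (m k) * ?w m)"
    using finite_padded_tuples by (intro sum.mono_neutral_right) auto
  also have "\<dots> = (\<Sum>m\<in>padded_tuples L (N - k). a k * ?w m)"
  proof (rule sum.reindex_bij_witness[of _ "\<lambda>m. m(k := Suc (m k))" "\<lambda>m. m(k := m k - 1)"])
    fix m assume m: "m \<in> {m \<in> padded_tuples L N. m k > 0}"
    then obtain j where j: "m k = Suc j" by (auto simp: gr0_conv_Suc)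
    show "(m(k := m k - 1))(k := Suc ((m(k := m k - 1)) k)) = m" using m by auto
    have "N - k = k * j + (\<Sum>i\<in>{1..L}-{k}. i * m i)"
      using m decomp[of m] j by (auto simp: padded_tuples_def)
    then show "m(k := m k - 1) \<in> padded_tuples L (N - k)"
      using m j decomp[of "m(k := m k - 1)"] by (auto simp: padded_tuples_def)
    show "a k * ?w (m(k := m k - 1)) = real (m k) * ?w m"
      unfolding decomp' j by (simp add: j field_simps del: of_nat_Suc)
  next
    fix m assume m: "m \<in> padded_tuples L (N - k)"
    show "(m(k := Suc (m k)))(k := (m(k := Suc (m k))) k - 1) = m" by auto
    have "N = k * Suc (m k) + (\<Sum>i\<in>{1..L}-{k}. i * m i)"
      using m decomp[of m] k by (auto simp: padded_tuples_def)
    then show "m(k := Suc (m k)) \<in> {m \<in> padded_tuples L N. m k > 0}"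
      using m decomp[of "m(k := Suc (m k))"] k by (auto simp: padded_tuples_def)
  qed
  finally show ?thesis by (simp add: sum_distrib_left)
qed

text \<open>Coefficient form of \<open>E' = A' E\<close>: on each tuple, \<open>N\<close> is
  rewritten as its weighted sum, the two sums are swapped, and entry \<open>k\<close> is
  decremented.\<close>

lemma exp_coeff_rec:
  "real N * exp_coeff a N = (\<Sum>k=1..N. real k * a k * exp_coeff a (N - k))"
proof -
  let ?w = "\<lambda>m. \<Prod>i=1..N. a i ^ m i / fact (m i)"
  have "real N * exp_coeff a N = (\<Sum>m\<in>padded_tuples N N. real N * ?w m)"
    by (simp add: exp_coeff_padded[of N N] sum_distrib_left)
  also have "\<dots> = (\<Sum>m\<in>padded_tuples N N. \<Sum>k=1..N. real k * (real (m k) * ?w m))"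
  proof (rule sum.cong[OF refl])
    fix m assume "m \<in> padded_tuples N N"
    then have "real N = (\<Sum>k=1..N. real k * real (m k))"
      unfolding padded_tuples_def of_nat_mult[symmetric] of_nat_sum[symmetric] by simp
    then show "real N * ?w m = (\<Sum>k=1..N. real k * (real (m k) * ?w m))"
      by (metis (no_types, lifting) sum_distrib_right mult.assoc sum.cong)
  qed
  also have "\<dots> = (\<Sum>k=1..N. real k * (\<Sum>m\<in>padded_tuples N N. real (m k) * ?w m))"
    by (subst sum.swap) (simp add: sum_distrib_left)
  also have "\<dots> = (\<Sum>k=1..N. real k * a k * exp_coeff a (N - k))"
  proof (rule sum.cong[OF refl])
    fix k assume "k \<in> {1..N}"
    then show "real k * (\<Sum>m\<in>padded_tuples N N. real (m k) * ?w m) = real k * a k * exp_coeff a (N - k)"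
      by (subst padded_tuples_decrement) (auto simp: exp_coeff_padded[of "N - k" N])
  qed
  finally show ?thesis .
qed

text \<open>A Cauchy-type majorant. Dropping the weight constraint enlarges the sum to all tuples
  with entries at most \<open>N\<close>; that sum factors into truncated exponential series, one for
  each \<open>k\<close>.\<close>

lemma abs_exp_coeff_le:
  assumes r: "r \<ge> 0"
  shows "\<bar>exp_coeff a N\<bar> * r ^ N \<le> exp (\<Sum>k=1..N. \<bar>a k\<bar> * r ^ k)"
proof -
  let ?b = "\<lambda>k i. (\<bar>a k\<bar> * r ^ k) ^ i / fact i :: real"
  have b: "?b k i \<ge> 0" for k i using r by simp
  have sub: "weighted_tuples N \<subseteq> {1..N} \<rightarrow>\<^sub>E {..N}"
  proof
    fix m assume "m \<in> weighted_tuples N"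
    then have "m \<in> extensional {1..N}" and sum: "(\<Sum>k=1..N. k * m k) = N"
      by (simp_all add: weighted_tuples_def PiE_iff)
    then show "m \<in> {1..N} \<rightarrow>\<^sub>E {..N}"
      using le_weighted_sum(2)[OF sum] unfolding PiE_iff atMost_iff by blast
  qed
  have "\<bar>exp_coeff a N\<bar> * r ^ N
      \<le> (\<Sum>m\<in>weighted_tuples N. \<bar>\<Prod>k=1..N. a k ^ m k / fact (m k)\<bar>) * r ^ N"
    unfolding exp_coeff_def using r by (intro mult_right_mono sum_abs) auto
  also have "\<dots> = (\<Sum>m\<in>weighted_tuples N. \<Prod>k=1..N. ?b k (m k))"
    unfolding sum_distrib_right
  proof (rule sum.cong[OF refl])
    fix m assume "m \<in> weighted_tuples N"
    then have "r ^ N = r ^ (\<Sum>k=1..N. k * m k)" by (simp add: weighted_tuples_def)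
    also have "\<dots> = (\<Prod>k=1..N. (r ^ k) ^ m k)" by (simp only: power_sum power_mult)
    finally have "\<bar>\<Prod>k=1..N. a k ^ m k / fact (m k)\<bar> * r ^ N
        = (\<Prod>k=1..N. \<bar>a k ^ m k / fact (m k)\<bar> * (r ^ k) ^ m k)"
      by (simp only: abs_prod prod.distrib)
    also have "\<dots> = (\<Prod>k=1..N. ?b k (m k))"
      by (intro prod.cong refl)
        (simp only: abs_divide power_abs power_mult_distrib abs_of_nonneg[OF fact_ge_zero]
          times_divide_eq_left)
    finally show "\<bar>\<Prod>k=1..N. a k ^ m k / fact (m k)\<bar> * r ^ N = (\<Prod>k=1..N. ?b k (m k))" .
  qed
  also have "\<dots> \<le> (\<Sum>m\<in>{1..N} \<rightarrow>\<^sub>E {..N}. \<Prod>k=1..N. ?b k (m k))"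
    by (rule sum_mono2[OF _ sub]) (auto intro!: finite_PiE prod_nonneg simp: r)
  also have "\<dots> = (\<Prod>k=1..N. \<Sum>i\<le>N. ?b k i)"
    by (rule prod_sum_PiE[symmetric]) auto
  also have "\<dots> \<le> (\<Prod>k=1..N. exp (\<bar>a k\<bar> * r ^ k))"
  proof (rule prod_mono, safe)
    fix k
    show "0 \<le> (\<Sum>i\<le>N. ?b k i)" using b by (intro sum_nonneg) auto
    have "(\<Sum>i\<le>N. ?b k i) \<le> (\<Sum>i. ?b k i)"
      using b summable_exp[of "\<bar>a k\<bar> * r ^ k"]
      by (intro sum_le_suminf) (simp_all only: divide_inverse mult.commute finite_atMost)
    also have "\<dots> = exp (\<bar>a k\<bar> * r ^ k)"
      unfolding exp_def by (simp only: real_scaleR_def divide_inverse mult.commute)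
    finally show "(\<Sum>i\<le>N. ?b k i) \<le> exp (\<bar>a k\<bar> * r ^ k)" .
  qed
  also have "\<dots> = exp (\<Sum>k=1..N. \<bar>a k\<bar> * r ^ k)" by (simp add: exp_sum)
  finally show ?thesis .
qed

text \<open>The majorant makes both series entire. By \<open>exp_coeff_rec\<close>,
  \<open>E * exp (- A)\<close> then has derivative zero, and its constant value is found at
  0.\<close>

lemma exp_coeff_sums:
  assumes a0: "a 0 = 0" and summ: "\<And>r::real. r \<ge> 0 \<Longrightarrow> summable (\<lambda>k. \<bar>a k\<bar> * r ^ k)"
  shows "(\<lambda>N. exp_coeff a N * z ^ N) sums exp (\<Sum>k. a k * z ^ k)"
proof -
  define A where "A = Abs_fps a"
  define E where "E = Abs_fps (exp_coeff a)"
  have summ': "summable (\<lambda>k. a k * r ^ k)" if "r > 0" for r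
  proof (rule summable_rabs_cancel)
    have "\<bar>a k * r ^ k\<bar> = \<bar>a k\<bar> * r ^ k" for k using that by (simp add: abs_mult)
    then show "summable (\<lambda>k. \<bar>a k * r ^ k\<bar>)" using summ[of r] that by simp
  qed
  have "conv_radius a \<ge> \<infinity>"
    by (rule conv_radius_geI_ex') (simp only: of_real_eq_id id_apply summ')
  then have radA: "fps_conv_radius A = \<infinity>" by (simp add: fps_conv_radius_def A_def)
  have "summable (\<lambda>k. exp_coeff a k * r ^ k)" if r: "r > 0" for r
  proof (rule summable_comparison_test)
    \<comment> \<open>Applying the majorant at radius \<open>2 * r\<close> leaves the summable
      factor \<open>(1/2) ^ k\<close> at radius \<open>r\<close>.\<close>
    let ?B = "exp (\<Sum>k. \<bar>a k\<bar> * (2 * r) ^ k)"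
    show "summable (\<lambda>k. ?B * (1/2) ^ k)" by (intro summable_mult summable_geometric) auto
    have "norm (exp_coeff a k * r ^ k) \<le> ?B * (1/2) ^ k" for k
    proof -
      have "\<bar>exp_coeff a k\<bar> * (2 * r) ^ k \<le> exp (\<Sum>k=1..k. \<bar>a k\<bar> * (2 * r) ^ k)"
        using r by (intro abs_exp_coeff_le) simp
      also have "(\<Sum>k=1..k. \<bar>a k\<bar> * (2 * r) ^ k) \<le> (\<Sum>k. \<bar>a k\<bar> * (2 * r) ^ k)"
        using r by (intro sum_le_suminf summ) simp_all
      finally have "\<bar>exp_coeff a k\<bar> * (2 * r) ^ k \<le> ?B" by simp
      then have "\<bar>exp_coeff a k\<bar> * (2 * r) ^ k * (1 / 2) ^ k \<le> ?B * (1 / 2) ^ k"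
        by (rule mult_right_mono) simp
      moreover have "(2 * r) ^ k * (1 / 2) ^ k = r ^ k"
        unfolding power_mult_distrib[symmetric] by simp
      ultimately have "\<bar>exp_coeff a k\<bar> * r ^ k \<le> ?B * (1 / 2) ^ k" by (simp only: mult.assoc)
      then show ?thesis using r by (simp only: abs_mult real_norm_def power_abs abs_of_pos)
    qed
    then show "\<exists>N. \<forall>k\<ge>N. norm (exp_coeff a k * r ^ k) \<le> ?B * (1/2) ^ k" by blast
  qed
  then have "conv_radius (exp_coeff a) \<ge> \<infinity>"
    by (intro conv_radius_geI_ex') (simp only: of_real_eq_id id_apply)
  then have radE: "fps_conv_radius E = \<infinity>" by (simp add: fps_conv_radius_def E_def)
  have radA': "fps_conv_radius (fps_deriv A) = \<infinity>"
    using fps_conv_radius_deriv[of A] radA by simp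
  have ode: "fps_deriv E = fps_deriv A * E"
  proof (rule fps_ext)
    fix n
    have "fps_nth (fps_deriv E) n = (\<Sum>k=1..Suc n. real k * a k * exp_coeff a (Suc n - k))"
      using exp_coeff_rec[of "Suc n" a] by (simp add: E_def)
    also have "\<dots> = (\<Sum>k=0..n. real (Suc k) * a (Suc k) * exp_coeff a (n - k))"
      unfolding One_nat_def sum.shift_bounds_cl_Suc_ivl by simp
    finally show "fps_nth (fps_deriv E) n = fps_nth (fps_deriv A * E) n"
      by (simp add: fps_mult_nth A_def E_def)
  qed
  have "\<exists>c. \<forall>x\<in>UNIV. eval_fps E x * exp (- eval_fps A x) = c"
  proof (rule has_field_derivative_zero_constant)
    fix x :: real
    have "(eval_fps E has_field_derivative eval_fps (fps_deriv A) x * eval_fps E x) (at x)"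
      using has_field_derivative_eval_fps[of x E] radE radA'
      by (simp add: ode eval_fps_mult)
    moreover have "(eval_fps A has_field_derivative eval_fps (fps_deriv A) x) (at x)"
      using radA by (intro has_field_derivative_eval_fps) auto
    ultimately show "((\<lambda>x. eval_fps E x * exp (- eval_fps A x)) has_field_derivative 0) (at x within UNIV)"
      by (auto intro!: derivative_eq_intros)
  qed auto
  then have "eval_fps E z * exp (- eval_fps A z) = eval_fps E 0 * exp (- eval_fps A 0)" by auto
  \<comment> \<open>\<open>weighted_tuples 0\<close> contains just the empty tuple, so the constant
    coefficient of \<open>E\<close> is 1.\<close>
  also have "\<dots> = 1"
    by (simp add: eval_fps_at_0 A_def E_def a0 exp_coeff_def weighted_tuples_def)
  finally have "eval_fps E z = exp (eval_fps A z)" by (simp add: exp_minus field_simps)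
  moreover have "(\<lambda>n. fps_nth E n * z ^ n) sums eval_fps E z"
    using radE by (intro sums_eval_fps) auto
  ultimately show ?thesis by (simp add: eval_fps_def A_def E_def)
qed

section \<open>Estimates for the exponentiated phase series\<close>

text \<open>The Taylor coefficients of \<open>- v (exp z - 1 - z - z\<^sup>2/2) / z\<^sup>2\<close>.\<close>

definition phase_coeff :: "real \<Rightarrow> nat \<Rightarrow> real" where
  "phase_coeff v k = (if k = 0 then 0 else - v / fact (k + 2))"

lemma summable_phase_coeff:
  fixes r :: real
  shows "summable (\<lambda>k. \<bar>phase_coeff v k\<bar> * r ^ k)"
proof (rule summable_comparison_test)
  show "summable (\<lambda>k. \<bar>v\<bar> * (\<bar>r\<bar> ^ k /\<^sub>R fact k))"
    by (intro summable_mult summable_exp_generic)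
  have "norm (\<bar>phase_coeff v k\<bar> * r ^ k) \<le> \<bar>v\<bar> * (\<bar>r\<bar> ^ k /\<^sub>R fact k)" for k
  proof -
    have "(fact k :: real) \<le> fact (k + 2)" by (intro fact_mono) auto
    then have "\<bar>v\<bar> / fact (k + 2) \<le> \<bar>v\<bar> / fact k" by (intro divide_left_mono) auto
    then have "\<bar>phase_coeff v k\<bar> \<le> \<bar>v\<bar> / fact k" by (simp add: phase_coeff_def)
    then have "\<bar>phase_coeff v k\<bar> * \<bar>r\<bar> ^ k \<le> \<bar>v\<bar> / fact k * \<bar>r\<bar> ^ k"
      by (intro mult_right_mono) auto
    then show ?thesis by (simp add: abs_mult power_abs field_simps)
  qed
  then show "\<exists>N. \<forall>k\<ge>N. norm (\<bar>phase_coeff v k\<bar> * r ^ k) \<le> \<bar>v\<bar> * (\<bar>r\<bar> ^ k /\<^sub>R fact k)"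
    by blast
qed

text \<open>The exponential series from order 3 on, with \<open>z\<^sup>2\<close> pulled out.
  Keeping this factor on the left avoids a division at \<open>z = 0\<close>.\<close>

lemma phase_coeff_suminf:
  fixes z :: real
  shows "z\<^sup>2 * (\<Sum>k. phase_coeff v k * z ^ k) = - v * (exp z - 1 - z - z\<^sup>2 / 2)"
proof -
  have "(\<lambda>k. z ^ k / fact k) sums exp z"
    using exp_converges[of z] by (simp add: field_simps)
  then have "(\<lambda>k. z ^ (k + 3) / fact (k + 3)) sums (exp z - (\<Sum>k<3. z ^ k / fact k))"
    by (rule sums_split_initial_segment)
  then have "(\<lambda>k. - v * (z ^ (k + 3) / fact (k + 3))) sums (- v * (exp z - 1 - z - z\<^sup>2 / 2))"
    by (intro sums_mult) (simp add: eval_nat_numeral algebra_simps)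
  moreover have "(\<lambda>k. - v * (z ^ (k + 3) / fact (k + 3))) = (\<lambda>k. z\<^sup>2 * (phase_coeff v (Suc k) * z ^ Suc k))"
    by (simp add: phase_coeff_def fun_eq_iff numeral_3_eq_3 power2_eq_square algebra_simps)
  ultimately have "(\<lambda>k. z\<^sup>2 * (phase_coeff v (Suc k) * z ^ Suc k)) sums (- v * (exp z - 1 - z - z\<^sup>2 / 2))"
    by simp
  moreover have "phase_coeff v 0 = 0" by (simp add: phase_coeff_def)
  ultimately have "(\<lambda>k. z\<^sup>2 * (phase_coeff v k * z ^ k)) sums (- v * (exp z - 1 - z - z\<^sup>2 / 2))"
    using sums_Suc_iff[of "\<lambda>k. z\<^sup>2 * (phase_coeff v k * z ^ k)"] by simp
  moreover have "summable (\<lambda>k. phase_coeff v k * z ^ k)"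
    by (rule summable_rabs_cancel) (unfold abs_mult power_abs, rule summable_phase_coeff)
  ultimately show ?thesis by (simp only: sums_iff suminf_mult)
qed

text \<open>The radius \<open>3/2\<close> in the coefficient estimate exceeds 1, so the Taylor tails decay geometrically;
  the rate \<open>2/5\<close> stays below \<open>1/2\<close>, so that the bound with \<open>v = u\<^sup>2\<close> is absorbed by the Gaussian.\<close>

lemma abs_exp_coeff_phase_le:
  assumes v: "v \<ge> 0"
  shows "\<bar>exp_coeff (phase_coeff v) j\<bar> \<le> exp (2 * v / 5) * (2 / 3) ^ j"
proof -
  \<comment> \<open>Equality holds at \<open>k = 1\<close>, and each further factor of the factorial
    is at least 4. Against \<open>(3/2) ^ k\<close> this leaves the ratio 3/8, whose geometric sum
    is at most 3/5; hence the rate \<open>2 * v / 3 * (3/5) = 2 * v / 5\<close>.\<close>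
  have fact_ge: "(3 / 2) * 4 ^ k \<le> (fact (k + 2) :: real)" if "k \<ge> 1" for k
    using that
  proof (induction k rule: dec_induct)
    case (step k)
    have "(3 / 2) * 4 ^ Suc k \<le> 4 * (fact (k + 2) :: real)"
      using step.IH unfolding power_Suc by linarith
    also have "\<dots> \<le> (real k + 3) * fact (k + 2)" using step by (intro mult_right_mono) auto
    also have "\<dots> = fact (Suc k + 2)" by simp
    finally show ?case .
  qed (simp add: eval_nat_numeral)
  have "(\<Sum>k=1..j. \<bar>phase_coeff v k\<bar> * (3 / 2) ^ k) \<le> (\<Sum>k=1..j. 2 * v / 3 * (3 / 8) ^ k)"
  proof (rule sum_mono)
    fix k assume k: "k \<in> {1..j}"
    have "\<bar>phase_coeff v k\<bar> * (3 / 2) ^ k = v / fact (k + 2) * (3 / 2) ^ k"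
      using k v by (simp add: phase_coeff_def)
    also have "\<dots> \<le> v / ((3 / 2) * 4 ^ k) * (3 / 2) ^ k"
      using k v fact_ge[of k] by (intro mult_right_mono divide_left_mono) auto
    also have "\<dots> = 2 * v / 3 * ((3 / 2) / 4) ^ k"
      by (simp only: power_divide) (simp add: mult_ac)
    finally show "\<bar>phase_coeff v k\<bar> * (3 / 2) ^ k \<le> 2 * v / 3 * (3 / 8) ^ k" by simp
  qed
  also have "\<dots> = 2 * v / 3 * (\<Sum>k=1..j. (3 / 8) ^ k)" by (simp add: sum_distrib_left)
  also have "\<dots> \<le> 2 * v / 3 * (3 / 5)"
  proof (rule mult_left_mono)
    have "(\<Sum>k=1..j. (3 / 8) ^ k) = 3 / 5 * (1 - (3 / 8 :: real) ^ j)"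
      by (induction j) (simp_all add: algebra_simps)
    then show "(\<Sum>k=1..j. (3 / 8) ^ k) \<le> (3 / 5 :: real)" by simp
  qed (use v in auto)
  finally have "(\<Sum>k=1..j. \<bar>phase_coeff v k\<bar> * (3 / 2) ^ k) \<le> 2 * v / 5" by simp
  then have "exp (\<Sum>k=1..j. \<bar>phase_coeff v k\<bar> * (3 / 2) ^ k) \<le> exp (2 * v / 5)" by simp
  with abs_exp_coeff_le[of "3 / 2" "phase_coeff v" j]
  have "\<bar>exp_coeff (phase_coeff v) j\<bar> * (3 / 2) ^ j \<le> exp (2 * v / 5)" by linarith
  then show ?thesis by (simp add: field_simps power_divide)
qed

lemma exp_phase_sums:
  "(\<lambda>j. exp_coeff (phase_coeff v) j * z ^ j) sums exp (\<Sum>k. phase_coeff v k * z ^ k)"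
proof (rule exp_coeff_sums)
  show "phase_coeff v 0 = 0" by (simp add: phase_coeff_def)
qed (rule summable_phase_coeff)

text \<open>In the tail all powers of \<open>\<bar>z\<bar> \<le> 1\<close> are bounded by the lowest
  one; the coefficients then leave a geometric series of ratio 2/3 and sum 3.\<close>

lemma exp_phase_remainder_small:
  assumes v: "v \<ge> 0" and z: "\<bar>z\<bar> \<le> 1"
  shows "\<bar>exp (\<Sum>k. phase_coeff v k * z ^ k) - (\<Sum>j\<le>N. exp_coeff (phase_coeff v) j * z ^ j)\<bar>
    \<le> 3 * exp (2 * v / 5) * \<bar>z\<bar> ^ Suc N"
proof -
  let ?t = "\<lambda>j. exp_coeff (phase_coeff v) j * z ^ j"
  let ?B = "exp (2 * v / 5) * \<bar>z\<bar> ^ Suc N"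
  have tail: "(\<lambda>j. ?t (j + Suc N)) sums (exp (\<Sum>k. phase_coeff v k * z ^ k) - (\<Sum>j\<le>N. ?t j))"
    using exp_phase_sums[of v z] unfolding lessThan_Suc_atMost[symmetric]
    by (rule sums_split_initial_segment)
  have geo: "(\<lambda>j. ?B * (2 / 3) ^ j) sums (?B * 3)"
    using geometric_sums[of "2 / 3 :: real"] by (intro sums_mult) simp
  have le: "norm (?t (j + Suc N)) \<le> ?B * (2 / 3) ^ j" for j
  proof -
    have "norm (?t (j + Suc N)) = \<bar>exp_coeff (phase_coeff v) (j + Suc N)\<bar> * \<bar>z\<bar> ^ (j + Suc N)"
      by (simp add: abs_mult power_abs)
    also have "\<dots> \<le> (exp (2 * v / 5) * (2 / 3) ^ (j + Suc N)) * \<bar>z\<bar> ^ Suc N"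
      using v z by (intro mult_mono abs_exp_coeff_phase_le power_decreasing) auto
    also have "\<dots> \<le> (exp (2 * v / 5) * (2 / 3) ^ j) * \<bar>z\<bar> ^ Suc N"
      by (intro mult_right_mono mult_left_mono power_decreasing) auto
    finally show ?thesis by (simp add: mult_ac)
  qed
  have "norm (suminf (\<lambda>j. ?t (j + Suc N))) \<le> suminf (\<lambda>j. ?B * (2 / 3) ^ j)"
    using le geo sums_summable by (intro norm_suminf_le) auto
  then show ?thesis
    unfolding sums_unique[OF tail, symmetric] sums_unique[OF geo, symmetric] by (simp add: mult_ac)
qed

text \<open>For \<open>\<bar>z\<bar> \<ge> 1\<close> all powers are instead raised to
  \<open>Suc N\<close>. The bound is deliberately that of the small case, so that both regimes end
  in one estimate.\<close>

lemma exp_phase_partial_sum_large: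
  assumes v: "v \<ge> 0" and z: "\<bar>z\<bar> \<ge> 1"
  shows "\<bar>\<Sum>j\<le>N. exp_coeff (phase_coeff v) j * z ^ j\<bar> \<le> 3 * exp (2 * v / 5) * \<bar>z\<bar> ^ Suc N"
proof -
  let ?B = "exp (2 * v / 5) * \<bar>z\<bar> ^ Suc N"
  have "\<bar>\<Sum>j\<le>N. exp_coeff (phase_coeff v) j * z ^ j\<bar>
      \<le> (\<Sum>j\<le>N. \<bar>exp_coeff (phase_coeff v) j\<bar> * \<bar>z\<bar> ^ j)"
    by (rule order_trans[OF sum_abs]) (simp add: abs_mult power_abs)
  also have "\<dots> \<le> (\<Sum>j\<le>N. exp (2 * v / 5) * (2 / 3) ^ j * \<bar>z\<bar> ^ Suc N)"
    using v z by (intro sum_mono mult_mono abs_exp_coeff_phase_le power_increasing) auto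
  also have "\<dots> = ?B * (\<Sum>j\<le>N. (2 / 3) ^ j)"
    unfolding sum_distrib_left by (intro sum.cong refl) (simp only: mult_ac)
  also have "\<dots> \<le> ?B * 3"
  proof (rule mult_left_mono)
    have "(\<Sum>j\<le>N. (2 / 3 :: real) ^ j) = 3 - 2 * (2 / 3) ^ N"
      by (induction N) simp_all
    then show "(\<Sum>j\<le>N. (2 / 3 :: real) ^ j) \<le> 3" by simp
  qed auto
  finally show ?thesis by (simp add: mult_ac)
qed

section \<open>Pointwise remainder of the Laplace integrand\<close>

text \<open>For \<open>z \<ge> - 2\<close> the inequality \<open>1 + z / 2 \<le> exp (z / 2)\<close>
  may be squared, giving \<open>z\<^sup>2 / 4\<close>; below \<open>- 2\<close> the term
  \<open>- 1 - z\<close> alone suffices. Linear growth gives exponential decay of the integrand away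
  from the saddle point.\<close>

lemma exp_minus_linear_ge:
  fixes z :: real
  assumes "\<bar>z\<bar> \<ge> 1"
  shows "exp z - 1 - z \<ge> \<bar>z\<bar> / 4"
proof (cases "z \<ge> - 2")
  case True
  have "(1 + z / 2) * (1 + z / 2) \<le> exp (z / 2) * exp (z / 2)"
    using True by (intro mult_mono exp_ge_add_one_self) auto
  also have "\<dots> = exp z" by (simp flip: exp_add)
  finally have "z\<^sup>2 / 4 \<le> exp z - 1 - z" by (simp add: power2_eq_square algebra_simps)
  moreover have "\<bar>z\<bar> * 1 \<le> \<bar>z\<bar> * \<bar>z\<bar>" using assms by (intro mult_left_mono) auto
  ultimately show ?thesis by (simp add: power2_eq_square)
next
  case False
  then show ?thesis using exp_gt_zero[of z] by linarith
qed

text \<open>The coefficient of \<open>s ^ j\<close> in the Laplace integrand at fixed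
  \<open>u\<close>, where \<open>s = 1 / sqrt x\<close> and \<open>z = u * s\<close>.\<close>

definition gauss_term :: "nat \<Rightarrow> real \<Rightarrow> real" where
  "gauss_term j u = exp (- u\<^sup>2 / 2) * exp_coeff (phase_coeff (u\<^sup>2)) j * u ^ j"

text \<open>The bound separates into a power of \<open>s\<close> and a function of \<open>u\<close>
  free of \<open>x\<close>, so integration over \<open>u\<close> preserves the order in
  \<open>s\<close>.\<close>

lemma laplace_integrand_remainder:
  fixes x u :: real
  assumes x: "x \<ge> 1"
  defines "s \<equiv> 1 / sqrt x"
  shows "\<bar>exp (- x * (exp (u * s) - 1 - u * s)) - (\<Sum>j\<le>N. gauss_term j u * s ^ j)\<bar>
    \<le> s ^ Suc N * ((3 * exp 1 + 1) * (\<bar>u\<bar> ^ Suc N * exp (- \<bar>u\<bar> / 4)))"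
proof -
  define z where "z = u * s"
  define S where "S = (\<Sum>j\<le>N. exp_coeff (phase_coeff (u\<^sup>2)) j * z ^ j)"
  have s: "s > 0" "s \<le> 1" "x * s\<^sup>2 = 1" using x by (auto simp: s_def power_divide)
  have xz: "x * z\<^sup>2 = u\<^sup>2" using s by (simp add: z_def power_mult_distrib)
  have abs_z: "\<bar>z\<bar> ^ Suc N = s ^ Suc N * \<bar>u\<bar> ^ Suc N"
    using s by (simp add: z_def abs_mult power_mult_distrib)
  have sum_eq: "(\<Sum>j\<le>N. gauss_term j u * s ^ j) = exp (- u\<^sup>2 / 2) * S"
    by (simp add: S_def gauss_term_def z_def power_mult_distrib sum_distrib_left mult_ac)
  have exponent: "- x * (exp z - 1 - z) = - u\<^sup>2 / 2 + (\<Sum>k. phase_coeff (u\<^sup>2) k * z ^ k)"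
  proof (cases "u = 0")
    case True
    then show ?thesis by (simp add: z_def phase_coeff_def)
  next
    case False
    then have "z \<noteq> 0" using s by (simp add: z_def)
    have "z\<^sup>2 * (\<Sum>k. phase_coeff (u\<^sup>2) k * z ^ k) = z\<^sup>2 * (- x * (exp z - 1 - z) + u\<^sup>2 / 2)"
      unfolding phase_coeff_suminf xz[symmetric] by (simp add: algebra_simps)
    with \<open>z \<noteq> 0\<close> show ?thesis by simp
  qed
  \<comment> \<open>The exponent is what remains of the Gaussian:
    \<open>- 1/2 + 2/5 = - 1/10\<close>. Completing the square around \<open>5/4\<close> trades it
    for a linear exponent.\<close>
  have gauss: "exp (- u\<^sup>2 / 10) \<le> exp 1 * exp (- \<bar>u\<bar> / 4)"
  proof -
    have "0 \<le> (\<bar>u\<bar> - 5 / 4)\<^sup>2" by simp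
    then have "- u\<^sup>2 / 10 \<le> 1 + - \<bar>u\<bar> / 4" by (simp add: power2_eq_square algebra_simps)
    then show ?thesis by (simp flip: exp_add)
  qed
  have combine: "exp (- u\<^sup>2 / 2) * (3 * exp (2 * u\<^sup>2 / 5) * \<bar>z\<bar> ^ Suc N)
      \<le> 3 * exp 1 * exp (- \<bar>u\<bar> / 4) * \<bar>z\<bar> ^ Suc N"
  proof -
    have "exp (- u\<^sup>2 / 2) * (3 * exp (2 * u\<^sup>2 / 5) * \<bar>z\<bar> ^ Suc N) = 3 * exp (- u\<^sup>2 / 10) * \<bar>z\<bar> ^ Suc N"
      by (simp add: exp_add[symmetric] mult_ac)
    also have "\<dots> \<le> 3 * (exp 1 * exp (- \<bar>u\<bar> / 4)) * \<bar>z\<bar> ^ Suc N"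
      using gauss by (intro mult_right_mono mult_left_mono) auto
    finally show ?thesis by simp
  qed
  \<comment> \<open>For \<open>\<bar>z\<bar> > 1\<close> the integrand and the partial sum are each small enough, as \<open>\<bar>z\<bar> ^ Suc N > 1\<close>.\<close>
  have "\<bar>exp (- x * (exp z - 1 - z)) - exp (- u\<^sup>2 / 2) * S\<bar>
      \<le> 3 * exp 1 * exp (- \<bar>u\<bar> / 4) * \<bar>z\<bar> ^ Suc N + exp (- \<bar>u\<bar> / 4) * \<bar>z\<bar> ^ Suc N"
  proof (cases "\<bar>z\<bar> \<le> 1")
    case True
    have "\<bar>exp (- x * (exp z - 1 - z)) - exp (- u\<^sup>2 / 2) * S\<bar>
        = exp (- u\<^sup>2 / 2) * \<bar>exp (\<Sum>k. phase_coeff (u\<^sup>2) k * z ^ k) - S\<bar>"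
      unfolding exponent exp_add by (simp add: abs_mult flip: right_diff_distrib)
    also have "\<dots> \<le> exp (- u\<^sup>2 / 2) * (3 * exp (2 * u\<^sup>2 / 5) * \<bar>z\<bar> ^ Suc N)"
      unfolding S_def using True by (intro mult_left_mono exp_phase_remainder_small) auto
    also have "\<dots> \<le> 3 * exp 1 * exp (- \<bar>u\<bar> / 4) * \<bar>z\<bar> ^ Suc N" by (rule combine)
    finally show ?thesis by (rule order_trans) simp
  next
    case False
    \<comment> \<open>This gives \<open>x * \<bar>z\<bar> \<ge> \<bar>u\<bar>\<close>, which makes
      the decay in \<open>u\<close> uniform in \<open>x\<close>.\<close>
    have "x * s \<ge> 1"
    proof -
      have "x * s = sqrt x" using x by (simp add: s_def real_div_sqrt)
      then show ?thesis using x by simp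
    qed
    have "\<bar>u\<bar> \<le> \<bar>u\<bar> * (x * s)" using \<open>x * s \<ge> 1\<close> by (simp add: mult_le_cancel_left1)
    also have "\<dots> = x * \<bar>z\<bar>" using s by (simp add: z_def abs_mult)
    finally have "\<bar>u\<bar> / 4 \<le> x * (\<bar>z\<bar> / 4)" by simp
    also have "\<dots> \<le> x * (exp z - 1 - z)"
      using False x by (intro mult_left_mono exp_minus_linear_ge) auto
    finally have "exp (- x * (exp z - 1 - z)) \<le> exp (- \<bar>u\<bar> / 4) * 1" by simp
    also have "\<dots> \<le> exp (- \<bar>u\<bar> / 4) * \<bar>z\<bar> ^ Suc N"
      using False by (intro mult_left_mono one_le_power) auto
    finally have 1: "exp (- x * (exp z - 1 - z)) \<le> exp (- \<bar>u\<bar> / 4) * \<bar>z\<bar> ^ Suc N" .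
    have "\<bar>exp (- u\<^sup>2 / 2) * S\<bar> = exp (- u\<^sup>2 / 2) * \<bar>S\<bar>" by (simp add: abs_mult)
    also have "\<dots> \<le> exp (- u\<^sup>2 / 2) * (3 * exp (2 * u\<^sup>2 / 5) * \<bar>z\<bar> ^ Suc N)"
      unfolding S_def using False by (intro mult_left_mono exp_phase_partial_sum_large) auto
    also note combine
    finally have "\<bar>exp (- u\<^sup>2 / 2) * S\<bar> \<le> 3 * exp 1 * exp (- \<bar>u\<bar> / 4) * \<bar>z\<bar> ^ Suc N" .
    with 1 show ?thesis
      using abs_triangle_ineq4[of "exp (- x * (exp z - 1 - z))" "exp (- u\<^sup>2 / 2) * S"] by simp
  qed
  also have "\<dots> = s ^ Suc N * ((3 * exp 1 + 1) * (\<bar>u\<bar> ^ Suc N * exp (- \<bar>u\<bar> / 4)))"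
    unfolding abs_z by (simp only: algebra_simps)
  finally show ?thesis unfolding sum_eq z_def .
qed

section \<open>The dominating function and the Laplace form of Euler's integral\<close>

lemma power_le_fact_exp:
  fixes y :: real
  assumes "y \<ge> 0"
  shows "y ^ n \<le> fact n * exp y"
proof -
  have "(\<Sum>k\<in>{n}. y ^ k /\<^sub>R fact k) \<le> (\<Sum>k. y ^ k /\<^sub>R fact k)"
    using assms by (intro sum_le_suminf summable_exp_generic) auto
  then show ?thesis by (simp add: exp_def field_simps)
qed

text \<open>Comparison with \<open>1 / (1 + u\<^sup>2)\<close>: the exponential absorbs both
  \<open>\<bar>u\<bar> ^ n\<close> and \<open>\<bar>u\<bar> ^ (n + 2)\<close>.\<close>

lemma integrable_power_exp_abs:
  "integrable lborel (\<lambda>u::real. \<bar>u\<bar> ^ n * exp (- \<bar>u\<bar> / 4))"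
proof (rule Bochner_Integration.integrable_bound)
  define c :: "nat \<Rightarrow> real" where "c = (\<lambda>k. fact k * 4 ^ k)"
  let ?C = "c n + c (n + 2)"
  show "integrable lborel (\<lambda>u::real. ?C * inverse (1 + u\<^sup>2))"
    using integrable_inverse_1_plus_square by (simp add: set_integrable_def)
  show "AE u::real in lborel. norm (\<bar>u\<bar> ^ n * exp (- \<bar>u\<bar> / 4)) \<le> norm (?C * inverse (1 + u\<^sup>2))"
  proof (rule always_eventually, rule allI)
    fix u :: real
    have le: "\<bar>u\<bar> ^ k \<le> c k * exp (\<bar>u\<bar> / 4)" for k
      using power_le_fact_exp[of "\<bar>u\<bar> / 4" k] by (simp add: c_def power_divide field_simps)
    have "\<bar>u\<bar> ^ n * (1 + u\<^sup>2) = \<bar>u\<bar> ^ n + \<bar>u\<bar> ^ (n + 2)" by (simp add: power2_eq_square algebra_simps)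
    also have "\<dots> \<le> ?C * exp (\<bar>u\<bar> / 4)" unfolding distrib_right by (intro add_mono le)
    finally have "\<bar>u\<bar> ^ n * (1 + u\<^sup>2) \<le> ?C * exp (\<bar>u\<bar> / 4)" .
    moreover have "1 + u\<^sup>2 > 0" by (simp add: add_pos_nonneg)
    ultimately have "\<bar>u\<bar> ^ n * exp (- \<bar>u\<bar> / 4) \<le> ?C * inverse (1 + u\<^sup>2)"
      by (simp add: exp_minus field_simps)
    then show "norm (\<bar>u\<bar> ^ n * exp (- \<bar>u\<bar> / 4)) \<le> norm (?C * inverse (1 + u\<^sup>2))"
      by (smt (verit) real_norm_def abs_of_nonneg mult_nonneg_nonneg exp_ge_zero zero_le_power abs_ge_zero)
  qed
qed measurable

text \<open>The substitution \<open>t = g u\<close> maps the line bijectively onto the positive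
  half-line; in its Jacobian \<open>x * s = sqrt x\<close> supplies the half power of
  \<open>x\<close>.\<close>

lemma Gamma_laplace_integral:
  fixes x :: real
  assumes x: "x > 0"
  defines "f \<equiv> \<lambda>u::real. exp (- x * (exp (u * (1 / sqrt x)) - 1 - u * (1 / sqrt x)))"
  shows "has_bochner_integral lborel f (Gamma x / (x powr (x - 1 / 2) * exp (- x)))"
proof -
  define s where "s = 1 / sqrt x"
  define g where "g = (\<lambda>u. x * exp (u * s))"
  define h where "h = (\<lambda>t. t powr (x - 1) / exp t)"
  have s: "s > 0" using x by (simp add: s_def)
  have img: "g ` UNIV = {0<..}"
  proof (intro equalityI subsetI)
    fix t :: real assume "t \<in> {0<..}"
    then have "t = g (ln (t / x) / s)" using x s by (simp add: g_def)
    then show "t \<in> g ` UNIV" by blast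
  qed (use x in \<open>auto simp: g_def\<close>)
  \<comment> \<open>Euler's integral is available on \<open>{0..}\<close>, but \<open>g\<close>
    never attains 0, so this single point is removed first.\<close>
  have "(h has_integral Gamma x) {0<..}"
  proof (subst has_integral_spike_set_eq)
    show "(h has_integral Gamma x) {0..}" unfolding h_def by (rule Gamma_integral_real[OF x])
    show "negligible {u \<in> {0<..} - {0..}. h u \<noteq> 0}"
      by (rule negligible_subset[of "{}"]) auto
    show "negligible {u \<in> {0..} - {0<..}. h u \<noteq> 0}"
      by (rule negligible_subset[of "{0}"]) auto
  qed
  then have "h absolutely_integrable_on {0<..}" "integral {0<..} h = Gamma x"
    by (auto intro!: nonnegative_absolutely_integrable_1 simp: h_def integral_unique has_integral_integrable)
  moreover have "(\<lambda>u. \<bar>x * s * exp (u * s)\<bar> * h (g u)) absolutely_integrable_on UNIV \<and>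
      integral UNIV (\<lambda>u. \<bar>x * s * exp (u * s)\<bar> * h (g u)) = Gamma x \<longleftrightarrow>
      h absolutely_integrable_on (g ` UNIV) \<and> integral (g ` UNIV) h = Gamma x"
  proof (rule has_absolute_integral_change_of_variables_1')
    show "(g has_field_derivative x * s * exp (u * s)) (at u within UNIV)" for u
      unfolding g_def by (auto intro!: derivative_eq_intros)
    show "inj_on g UNIV" using x s by (auto simp: inj_on_def g_def)
  qed auto
  moreover have "\<bar>x * s * exp (u * s)\<bar> * h (g u) = x powr (x - 1 / 2) * exp (- x) * f u" for u
  proof -
    have "\<bar>x * s * exp (u * s)\<bar> * h (g u) = x powr (x - 1) * (x * s) *
        (exp (u * s) * (exp (u * s) powr (x - 1) / exp (x * exp (u * s))))"
      using x s by (simp add: h_def g_def powr_mult abs_mult)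
    moreover have "x powr (x - 1) * (x * s) = x powr (x - 1 / 2)"
    proof -
      have "x * s = x powr (1 / 2)" using x by (simp add: s_def powr_half_sqrt real_div_sqrt)
      then show ?thesis using x by (simp flip: powr_add)
    qed
    moreover have "exp (u * s) * (exp (u * s) powr (x - 1) / exp (x * exp (u * s))) = exp (- x) * f u"
      unfolding f_def s_def[symmetric]
      by (simp add: powr_def exp_add[symmetric] exp_diff[symmetric] algebra_simps)
    ultimately show ?thesis by (simp only: mult.assoc)
  qed
  ultimately have abs: "(\<lambda>u. x powr (x - 1 / 2) * exp (- x) * f u) absolutely_integrable_on UNIV"
    and int: "integral UNIV (\<lambda>u. x powr (x - 1 / 2) * exp (- x) * f u) = Gamma x"
    using img by simp_all
  \<comment> \<open>Borel measurability allows passing from the completed measure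
    \<open>lebesgue\<close> back to \<open>lborel\<close>.\<close>
  have meas: "f \<in> borel_measurable borel" unfolding f_def by measurable
  have "integrable lebesgue (\<lambda>u. x powr (x - 1 / 2) * exp (- x) * f u)"
    using abs by (simp add: set_integrable_def)
  then have "integrable lborel f"
    using x meas by (simp add: integrable_completion)
  moreover have "integral\<^sup>L lborel f = integral UNIV f"
    using \<open>integrable lborel f\<close> by (simp add: integral_lborel)
  moreover have "integral UNIV f = Gamma x / (x powr (x - 1 / 2) * exp (- x))"
    using int x by (simp add: field_simps)
  ultimately show ?thesis by (simp add: has_bochner_integral_iff)
qed

section \<open>Gaussian moments of the expansion terms\<close>

text \<open>Isolating the power of \<open>v\<close> makes each tuple contribute a single monomial in
  \<open>u\<close> once \<open>v = u\<^sup>2\<close>.\<close>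

lemma exp_coeff_phase:
  "exp_coeff (phase_coeff v) j = (\<Sum>m\<in>weighted_tuples j. (- 1) ^ (\<Sum>k=1..j. m k) /
    (\<Prod>k=1..j. fact (m k) * fact (k + 2) ^ m k) * v ^ (\<Sum>k=1..j. m k))"
  unfolding exp_coeff_def
proof (rule sum.cong[OF refl])
  fix m
  have "(\<Prod>k=1..j. phase_coeff v k ^ m k / fact (m k))
      = (\<Prod>k=1..j. (- v) ^ m k / (fact (m k) * fact (k + 2) ^ m k))"
  proof (rule prod.cong[OF refl])
    fix k assume "k \<in> {1..j}"
    then have "phase_coeff v k = (- v) / fact (k + 2)" by (simp add: phase_coeff_def)
    then show "phase_coeff v k ^ m k / fact (m k) = (- v) ^ m k / (fact (m k) * fact (k + 2) ^ m k)"
      by (simp only: power_divide divide_divide_eq_left mult.commute)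
  qed
  also have "\<dots> = (- v) ^ (\<Sum>k=1..j. m k) / (\<Prod>k=1..j. fact (m k) * fact (k + 2) ^ m k)"
    by (simp add: prod_dividef power_sum)
  also have "\<dots> = (- 1) ^ (\<Sum>k=1..j. m k) / (\<Prod>k=1..j. fact (m k) * fact (k + 2) ^ m k) * v ^ (\<Sum>k=1..j. m k)"
    by (subst power_minus) simp
  finally show "(\<Prod>k=1..j. phase_coeff v k ^ m k / fact (m k)) = \<dots>" .
qed

text \<open>The Gaussian is normalised to \<open>std_normal_density\<close>, which reduces the
  integral to moments of the normal distribution.\<close>

lemma gauss_term_expand:
  "gauss_term j u = (\<Sum>m\<in>weighted_tuples j. sqrt (2 * pi) * (- 1) ^ (\<Sum>k=1..j. m k) /
    (\<Prod>k=1..j. fact (m k) * fact (k + 2) ^ m k) * (std_normal_density u * u ^ (2 * (\<Sum>k=1..j. m k) + j)))"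
  unfolding gauss_term_def exp_coeff_phase
    sum_distrib_left[where A = "weighted_tuples j"] sum_distrib_right[where A = "weighted_tuples j"]
  by (intro sum.cong refl) (simp only: std_normal_density_def power_add power_mult, simp)

lemma gauss_term_integrable: "integrable lborel (gauss_term j)"
  unfolding gauss_term_expand[abs_def]
  by (intro Bochner_Integration.integrable_sum integrable_mult_right integrable_std_normal_moment)

lemma gauss_term_integral:
  "integral\<^sup>L lborel (gauss_term j) = (\<Sum>m\<in>weighted_tuples j. sqrt (2 * pi) * (- 1) ^ (\<Sum>k=1..j. m k) /
    (\<Prod>k=1..j. fact (m k) * fact (k + 2) ^ m k) *
    (LBINT u. std_normal_density u * u ^ (2 * (\<Sum>k=1..j. m k) + j)))"
  unfolding gauss_term_expand[abs_def]
  by (subst Bochner_Integration.integral_sum)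
     (auto intro!: integrable_mult_right integrable_std_normal_moment)

lemma gauss_term_integral_odd:
  assumes "odd j"
  shows "integral\<^sup>L lborel (gauss_term j) = 0"
proof -
  have "(LBINT u. std_normal_density u * u ^ (2 * k + j)) = 0" for k
  proof -
    obtain i where "2 * k + j = 2 * i + 1" using assms by (metis odd_add even_mult_iff even_numeral oddE)
    then show ?thesis using integral_std_normal_moment_odd[of i] by simp
  qed
  then show ?thesis by (simp add: gauss_term_integral)
qed

text \<open>The left side is the even moment of order \<open>2 * k\<close>. From \<open>k\<close> to
  \<open>k + 1\<close> both sides gain the factor \<open>2 * k + 1 = 2 * (1/2 + k)\<close>.\<close>

lemma gaussian_moment_pochhammer: "fact (2 * k) / (2 ^ k * fact k) = 2 ^ k * pochhammer (1 / 2 :: real) k"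
proof (induction k)
  case (Suc k)
  have "fact (2 * Suc k) / (2 ^ Suc k * fact (Suc k)) = (2 * real k + 1) * (fact (2 * k) / (2 ^ k * fact k :: real))"
    by (simp add: divide_simps)
  also have "\<dots> = 2 ^ Suc k * pochhammer (1 / 2) (Suc k)"
    unfolding Suc.IH by (simp add: pochhammer_Suc algebra_simps)
  finally show ?case .
qed simp

lemma gauss_term_integral_even:
  "integral\<^sup>L lborel (gauss_term (2 * n)) = sqrt (2 * pi) * (2 ^ n * (\<Sum>m\<in>weighted_tuples (2 * n).
     (- 2) ^ (\<Sum>k=1..2*n. m k) * pochhammer (1/2 :: real) ((\<Sum>k=1..2*n. m k) + n) /
     (\<Prod>k=1..2*n. fact (m k) * (fact (k + 2)) ^ m k)))"
  unfolding gauss_term_integral sum_distrib_left[where A = "weighted_tuples (2 * n)"]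
proof (rule sum.cong[OF refl])
  fix m :: "nat \<Rightarrow> nat"
  define M where "M = (\<Sum>k=1..2*n. m k)"
  have "(LBINT u. std_normal_density u * u ^ (2 * M + 2 * n)) = 2 ^ (M + n) * pochhammer (1 / 2) (M + n)"
    using integral_std_normal_moment_even[of "M + n"] gaussian_moment_pochhammer[of "M + n"] by simp
  \<comment> \<open>Of the factor \<open>2 ^ (M + n)\<close> in the moment, \<open>2 ^ M\<close>
    joins the sign and \<open>2 ^ n\<close> moves in front of the sum.\<close>
  moreover have "(- 2 :: real) ^ M = (- 1) ^ M * 2 ^ M" by (rule power_minus)
  ultimately show "sqrt (2 * pi) * (- 1) ^ (\<Sum>k=1..2*n. m k) /
      (\<Prod>k=1..2*n. fact (m k) * fact (k + 2) ^ m k) *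
      (LBINT u. std_normal_density u * u ^ (2 * (\<Sum>k=1..2*n. m k) + 2 * n)) =
    sqrt (2 * pi) * (2 ^ n * ((- 2) ^ (\<Sum>k=1..2*n. m k) * pochhammer (1 / 2) ((\<Sum>k=1..2*n. m k) + n) /
      (\<Prod>k=1..2*n. fact (m k) * fact (k + 2) ^ m k)))"
    unfolding M_def[symmetric] by (simp add: power_add mult_ac)
qed

section \<open>The asymptotic expansion and its coefficients\<close>

lemma Gamma_expansion_bound:
  fixes x :: real
  assumes x: "x \<ge> 1"
  shows "\<bar>Gamma x / (x powr (x - 1 / 2) * exp (- x)) - (\<Sum>i\<le>n. integral\<^sup>L lborel (gauss_term (2 * i)) / x ^ i)\<bar>
    \<le> (LBINT u::real. (3 * exp 1 + 1) * (\<bar>u\<bar> ^ Suc (2 * n) * exp (- \<bar>u\<bar> / 4))) * (1 / sqrt x) ^ Suc (2 * n)"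
proof -
  define s where "s = 1 / sqrt x"
  let ?f = "\<lambda>u::real. exp (- x * (exp (u * s) - 1 - u * s))"
  let ?S = "\<lambda>u. \<Sum>j\<le>2*n. gauss_term j u * s ^ j"
  let ?D = "\<lambda>u::real. (3 * exp 1 + 1) * (\<bar>u\<bar> ^ Suc (2 * n) * exp (- \<bar>u\<bar> / 4))"
  have f: "has_bochner_integral lborel ?f (Gamma x / (x powr (x - 1 / 2) * exp (- x)))"
    unfolding s_def using x by (intro Gamma_laplace_integral) auto
  have f_int: "integrable lborel ?f" using f by (simp only: has_bochner_integral_iff)
  have S: "integrable lborel ?S"
    by (intro Bochner_Integration.integrable_sum integrable_mult_left gauss_term_integrable)
  have D: "integrable lborel ?D" by (intro integrable_mult_right integrable_power_exp_abs)
  have "integral\<^sup>L lborel ?S = (\<Sum>j\<le>2*n. integral\<^sup>L lborel (gauss_term j) * s ^ j)"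
    by (subst Bochner_Integration.integral_sum) (auto intro!: integrable_mult_left gauss_term_integrable)
  \<comment> \<open>Only even \<open>j = 2 * i\<close> survive, and
    \<open>s ^ (2 * i) = 1 / x ^ i\<close>, so half-integer powers of \<open>x\<close>
    disappear.\<close>
  also have "\<dots> = (\<Sum>j\<in>(\<lambda>i. 2 * i) ` {..n}. integral\<^sup>L lborel (gauss_term j) * s ^ j)"
  proof (rule sum.mono_neutral_right)
    show "\<forall>j\<in>{..2 * n} - (\<lambda>i. 2 * i) ` {..n}. integral\<^sup>L lborel (gauss_term j) * s ^ j = 0"
      by (auto simp: image_iff intro!: gauss_term_integral_odd)
  qed auto
  also have "\<dots> = (\<Sum>i\<le>n. integral\<^sup>L lborel (gauss_term (2 * i)) / x ^ i)"
    using x by (subst sum.reindex) (auto simp: inj_on_def s_def power_mult power_divide)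
  finally have int_S: "integral\<^sup>L lborel ?S = \<dots>" .
  have "\<bar>integral\<^sup>L lborel (\<lambda>u. ?f u - ?S u)\<bar> \<le> integral\<^sup>L lborel (\<lambda>u. \<bar>?f u - ?S u\<bar>)"
    by (rule integral_abs_bound)
  also have "\<dots> \<le> integral\<^sup>L lborel (\<lambda>u. s ^ Suc (2 * n) * ?D u)"
    using f S D laplace_integrand_remainder[OF x, folded s_def]
    by (intro integral_mono integrable_abs Bochner_Integration.integrable_diff integrable_mult_right)
       (auto simp: has_bochner_integral_iff)
  also have "\<dots> = integral\<^sup>L lborel ?D * s ^ Suc (2 * n)"
    by (simp only: integral_mult_right_zero mult.commute)
  also have "integral\<^sup>L lborel (\<lambda>u. ?f u - ?S u) = Gamma x / (x powr (x - 1 / 2) * exp (- x)) -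
      (\<Sum>i\<le>n. integral\<^sup>L lborel (gauss_term (2 * i)) / x ^ i)"
    using Bochner_Integration.integral_diff[OF f_int S]
    by (simp only: has_bochner_integral_integral_eq[OF f] int_S)
  finally show ?thesis unfolding s_def .
qed

lemma Gamma_poincare_expansion:
  "poincare_expansion (\<lambda>x. Gamma x / (sqrt (2 * pi) * x powr (x - 1/2) * exp (- x)))
     (\<lambda>i. integral\<^sup>L lborel (gauss_term (2 * i)) / sqrt (2 * pi))"
  unfolding poincare_expansion_def
proof
  fix n
  let ?F = "\<lambda>x. Gamma x / (sqrt (2 * pi) * x powr (x - 1/2) * exp (- x)) -
      (\<Sum>i\<le>n. integral\<^sup>L lborel (gauss_term (2 * i)) / sqrt (2 * pi) / x ^ i)"
  define K where "K = (LBINT u::real. (3 * exp 1 + 1) * (\<bar>u\<bar> ^ Suc (2 * n) * exp (- \<bar>u\<bar> / 4))) / sqrt (2 * pi)"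
  have "?F \<in> O[at_top](\<lambda>x. (1 / sqrt x) ^ Suc (2 * n))"
  proof (rule landau_o.bigI)
    show "\<bar>K\<bar> + 1 > 0" by simp
    show "\<forall>\<^sub>F x in at_top. norm (?F x) \<le> (\<bar>K\<bar> + 1) * norm ((1 / sqrt x) ^ Suc (2 * n))"
      using eventually_ge_at_top[of 1]
    proof eventually_elim
      case (elim x)
      have eq: "?F x = (Gamma x / (x powr (x - 1 / 2) * exp (- x)) -
          (\<Sum>i\<le>n. integral\<^sup>L lborel (gauss_term (2 * i)) / x ^ i)) / sqrt (2 * pi)"
        by (simp add: diff_divide_distrib sum_divide_distrib mult_ac)
      have "norm (?F x) = \<bar>Gamma x / (x powr (x - 1 / 2) * exp (- x)) -
          (\<Sum>i\<le>n. integral\<^sup>L lborel (gauss_term (2 * i)) / x ^ i)\<bar> / sqrt (2 * pi)"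
        unfolding eq by simp
      also have "\<dots> \<le> K * (1 / sqrt x) ^ Suc (2 * n)"
        unfolding K_def times_divide_eq_left
        by (rule divide_right_mono[OF Gamma_expansion_bound[OF elim]]) simp
      also have "\<dots> \<le> (\<bar>K\<bar> + 1) * (1 / sqrt x) ^ Suc (2 * n)"
        using elim by (intro mult_right_mono) auto
      also have "\<dots> = (\<bar>K\<bar> + 1) * norm ((1 / sqrt x) ^ Suc (2 * n))"
        using elim by simp
      finally show ?case .
    qed
  qed
  \<comment> \<open>The quotient of the two sides is exactly \<open>1 / sqrt x\<close>: stopping at
    order \<open>2 * n\<close> in \<open>s\<close> gains half a power of \<open>x\<close>.\<close>
  also have "(\<lambda>x. (1 / sqrt x) ^ Suc (2 * n)) \<in> o[at_top](\<lambda>x. 1 / x ^ n)"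
  proof (rule smalloI_tendsto)
    have "((\<lambda>x. 1 / sqrt x) \<longlongrightarrow> 0) at_top"
      by (intro tendsto_divide_0[OF tendsto_const] filterlim_at_top_imp_at_infinity sqrt_at_top)
    moreover have "\<forall>\<^sub>F x in at_top. 1 / sqrt x = (1 / sqrt x) ^ Suc (2 * n) / (1 / x ^ n)"
      using eventually_gt_at_top[of 0]
      by eventually_elim (simp add: power_mult power_divide)
    ultimately show "((\<lambda>x. (1 / sqrt x) ^ Suc (2 * n) / (1 / x ^ n)) \<longlongrightarrow> 0) at_top"
      by (rule Lim_transform_eventually)
    show "\<forall>\<^sub>F x::real in at_top. 1 / x ^ n \<noteq> 0"
      using eventually_gt_at_top[of 0] by eventually_elim auto
  qed
  finally show "?F \<in> o[at_top](\<lambda>x. 1 / x ^ n)" .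
qed

theorem theorem1:
  fixes n :: nat
  assumes "n \<ge> 1"
  shows "stirling_coeff n =
    (- 2) ^ n * (\<Sum>m\<in>weighted_tuples (2 * n).
       (- 2) ^ (\<Sum>k=1..2*n. m k) * pochhammer (1/2 :: real) ((\<Sum>k=1..2*n. m k) + n) /
       (\<Prod>k=1..2*n. fact (m k) * (fact (k + 2)) ^ m k))"
proof -
  \<comment> \<open>The sign \<open>(- 1) ^ i\<close> in the defining expansion cancels against the
    one placed here; it later turns \<open>2 ^ n\<close> into \<open>(- 2) ^ n\<close>.\<close>
  have "stirling_coeff = (\<lambda>i. (- 1) ^ i * (integral\<^sup>L lborel (gauss_term (2 * i)) / sqrt (2 * pi)))"
    using Gamma_poincare_expansion by (intro stirling_coeff_eqI) (simp flip: mult.assoc power_mult_distrib)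
  then have "stirling_coeff n = (- 1) ^ n * (integral\<^sup>L lborel (gauss_term (2 * n)) / sqrt (2 * pi))"
    by (rule fun_cong)
  also have "integral\<^sup>L lborel (gauss_term (2 * n)) / sqrt (2 * pi) =
      2 ^ n * (\<Sum>m\<in>weighted_tuples (2 * n).
       (- 2) ^ (\<Sum>k=1..2*n. m k) * pochhammer (1/2 :: real) ((\<Sum>k=1..2*n. m k) + n) /
       (\<Prod>k=1..2*n. fact (m k) * (fact (k + 2)) ^ m k))"
    unfolding gauss_term_integral_even by (rule nonzero_mult_div_cancel_left) simp
  finally show ?thesis by (simp only: power_minus[of "2 :: real" n] mult.assoc)
qed

end
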